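(* For every $n\in\mathbb N$, the $C^*$-algebra $M_n$ of complex $n\times n$ matrices has the uniform Dixmier property with constants $m=2$ and $\gamma=1/2$, and the uniform singleton Dixmier property with constants $M=4$ and $\Upsilon=1/2$.
   Context: Let $A$ be a unital $C^*$-algebra with centre $Z(A)$ and unitary group $\mathcal U(A)$. $A$ has the uniform Dixmier property with constants $(m,\gamma)$ ($m\in\mathbb N$, $0<\gamma<1$) if for every self-adjoint $a\in A$ there exist $z\in Z(A)$ and $u_1,\dots,u_m\in\mathcal U(A)$ with $\|\sum_{i=1}^m\frac1mu_iau_i^*-z\|\le\gamma\|a\|$. For $a\in A$, $D_A(a)$ is the norm-closed convex hull of $\{uau^*:u\in\mathcal U(A)\}$; $A$ has the singleton Dixmier property if $D_A(a)\cap Z(A)$ is a singleton for all $a\in A$, and then $R:A\to Z(A)$ denotes the map with $\{R(a)\}=D_A(a)\cap Z(A)$ (the unique centre-valued trace of $A$). $A$ has the uniform singleton Dixmier property with constants $(M,\Upsilon)$ ($M\in\mathbb N$, $0<\Upsilon<1$) if $A$ has the singleton Dixmier property and for every self-adjoint $a\in A$ there exist $u_1,\dots,u_M\in\mathcal U(A)$ with $\|\sum_{i=1}^M\frac1Mu_iau_i^*-R(a)\|\le\Upsilon\|a-R(a)\|$. *)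

theory Defs
  imports "HOL-Analysis.Analysis"
begin

section \<open>Unital C*-algebras\<close>

text \<open>
  The real vector space, the multiplication and the norm come from the library classes
  (\<^class>\<open>real_normed_algebra_1\<close>, \<^class>\<open>banach\<close>); the complex scalars and the involution are added.
  \<^class>\<open>real_normed_algebra_1\<close> demands that the norm of 1 is 1, i.e. the algebra is nonzero.
\<close>

class unital_cstar_algebra = real_normed_algebra_1 + banach +
  fixes scaleC :: "complex \<Rightarrow> 'a \<Rightarrow> 'a"  (infixr \<open>*\<^sub>C\<close> 75)
    and star :: "'a \<Rightarrow> 'a"
  assumes scaleC_add_right: "c *\<^sub>C (a + b) = c *\<^sub>C a + c *\<^sub>C b"
    and scaleC_add_left: "(c + d) *\<^sub>C a = c *\<^sub>C a + d *\<^sub>C a"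
    and scaleC_scaleC: "c *\<^sub>C d *\<^sub>C a = (c * d) *\<^sub>C a"
    and scaleC_of_real: "complex_of_real r *\<^sub>C a = r *\<^sub>R a"
    and mult_scaleC_left: "(c *\<^sub>C a) * b = c *\<^sub>C (a * b)"
    and mult_scaleC_right: "a * (c *\<^sub>C b) = c *\<^sub>C (a * b)"
    and norm_scaleC: "norm (c *\<^sub>C a) = cmod c * norm a"
    and star_star: "star (star a) = a"
    and star_add: "star (a + b) = star a + star b"
    and star_scaleC: "star (c *\<^sub>C a) = cnj c *\<^sub>C star a"
    and star_mult: "star (a * b) = star b * star a"
    and cstar_identity: "norm (star a * a) = (norm a)\<^sup>2"

definition selfadjoint :: "'a::unital_cstar_algebra \<Rightarrow> bool"
  where "selfadjoint a \<longleftrightarrow> star a = a"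

definition unitary_group :: "'a::unital_cstar_algebra set"
  where "unitary_group = {u. star u * u = 1 \<and> u * star u = 1}"

definition centre :: "'a::unital_cstar_algebra set"
  where "centre = {z. \<forall>a. z * a = a * z}"


section \<open>Dixmier properties\<close>

definition dixmier_set :: "'a::unital_cstar_algebra \<Rightarrow> 'a set"
  where "dixmier_set a = closure (convex hull {u * a * star u | u. u \<in> unitary_group})"

definition unitary_average :: "nat \<Rightarrow> (nat \<Rightarrow> 'a) \<Rightarrow> 'a \<Rightarrow> 'a::unital_cstar_algebra"
  where "unitary_average m u a = (\<Sum>i=1..m. (1 / real m) *\<^sub>R (u i * a * star (u i)))"

text \<open>The \<^typ>\<open>'a itself\<close> argument names the algebra: the property of \<open>A\<close> is written with \<open>TYPE(A)\<close>.\<close>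

definition uniform_dixmier_property :: "'a::unital_cstar_algebra itself \<Rightarrow> nat \<Rightarrow> real \<Rightarrow> bool"
  where "uniform_dixmier_property _ m \<gamma> \<longleftrightarrow>
    1 \<le> m \<and> 0 < \<gamma> \<and> \<gamma> < 1 \<and>
    (\<forall>a::'a. selfadjoint a \<longrightarrow>
      (\<exists>z\<in>centre. \<exists>u. (\<forall>i\<in>{1..m}. u i \<in> unitary_group) \<and>
        norm (unitary_average m u a - z) \<le> \<gamma> * norm a))"

definition singleton_dixmier_property :: "'a::unital_cstar_algebra itself \<Rightarrow> bool"
  where "singleton_dixmier_property _ \<longleftrightarrow> (\<forall>a::'a. \<exists>z. dixmier_set a \<inter> centre = {z})"

text \<open>Meaningful only under the singleton Dixmier property.\<close>

definition centre_trace :: "'a::unital_cstar_algebra \<Rightarrow> 'a"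
  where "centre_trace a = (THE z. dixmier_set a \<inter> centre = {z})"

definition uniform_singleton_dixmier_property ::
    "'a::unital_cstar_algebra itself \<Rightarrow> nat \<Rightarrow> real \<Rightarrow> bool"
  where "uniform_singleton_dixmier_property _ M \<Upsilon> \<longleftrightarrow>
    1 \<le> M \<and> 0 < \<Upsilon> \<and> \<Upsilon> < 1 \<and>
    singleton_dixmier_property TYPE('a) \<and>
    (\<forall>a::'a. selfadjoint a \<longrightarrow>
      (\<exists>u. (\<forall>i\<in>{1..M}. u i \<in> unitary_group) \<and>
        norm (unitary_average M u a - centre_trace a) \<le> \<Upsilon> * norm (a - centre_trace a)))"


section \<open>The C*-algebra of complex n by n matrices\<close>

text \<open>
  A copy of \<^typ>\<open>complex^'n^'n\<close>, because that type already carries the entrywise product and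
  the Frobenius norm. Here the product is the matrix product and the norm is the operator
  norm for the Euclidean norm on \<^typ>\<open>complex^'n\<close>.
\<close>

typedef 'n cmatrix = "UNIV :: (complex^'n^'n) set"
  morphisms to_vec of_vec ..

setup_lifting type_definition_cmatrix

lemma cmatrix_vector_scaleR: "(r *\<^sub>R A) *v x = r *\<^sub>R (A *v (x::complex^'n))"
  for A :: "complex^'n^'m"
  by (simp add: vec_eq_iff matrix_vector_mult_def scaleR_sum_right)

lemma cmatrix_bounded_linear: "bounded_linear ((*v) (A::complex^'n::finite^'m::finite))"
  by (simp add: linear_conv_bounded_linear[symmetric])

lemma cmatrix_norm_mult_vec: "norm (A *v x) \<le> onorm ((*v) A) * norm x"
  for A :: "complex^'n::finite^'m::finite"
  by (rule onorm[OF cmatrix_bounded_linear])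

lemma norm_entry_le_onorm: "norm (A $ i $ j) \<le> onorm ((*v) A)"
  for A :: "complex^'n::finite^'m::finite"
proof -
  have "A $ i $ j = (A *v axis j 1) $ i"
    by (simp add: matrix_vector_mult_def axis_def if_distrib cong: if_cong)
  also have "norm \<dots> \<le> norm (A *v axis j 1)" by (rule Finite_Cartesian_Product.norm_nth_le)
  also have "\<dots> \<le> onorm ((*v) A) * norm (axis j (1::complex) :: complex^'n)"
    by (rule cmatrix_norm_mult_vec)
  finally show ?thesis by simp
qed

lemma norm_le_onorm: "norm A \<le> real (CARD('m) * CARD('n)) * onorm ((*v) A)"
  for A :: "complex^'n::finite^'m::finite"
proof -
  have "norm (A $ i) \<le> real CARD('n) * onorm ((*v) A)" for i
  proof -
    have "norm (A $ i) \<le> (\<Sum>j\<in>UNIV. norm (A $ i $ j))"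
      unfolding norm_vec_def by (rule L2_set_le_sum) simp
    also have "\<dots> \<le> (\<Sum>j\<in>(UNIV::'n set). onorm ((*v) A))"
      by (intro sum_mono norm_entry_le_onorm)
    finally show ?thesis by simp
  qed
  moreover have "norm A \<le> (\<Sum>i\<in>UNIV. norm (A $ i))"
    unfolding norm_vec_def[of A] by (rule L2_set_le_sum) simp
  ultimately have "norm A \<le> (\<Sum>i\<in>(UNIV::'m set). real CARD('n) * onorm ((*v) A))"
    by (meson order_trans sum_mono)
  then show ?thesis by simp
qed

lemma onorm_le_norm: "onorm ((*v) A) \<le> real (CARD('m) * CARD('n)) * norm A"
  for A :: "complex^'n::finite^'m::finite"
proof (rule onorm_bound)
  fix x :: "complex^'n"
  have "norm ((A *v x) $ i) \<le> real CARD('n) * (norm A * norm x)" for i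
  proof -
    have "norm ((A *v x) $ i) \<le> (\<Sum>j\<in>UNIV. norm (A $ i $ j * x $ j))"
      unfolding matrix_vector_mult_def by (simp add: norm_sum)
    also have "\<dots> \<le> (\<Sum>j\<in>(UNIV::'n set). norm A * norm x)"
      unfolding norm_mult
      by (intro sum_mono mult_mono)
        (auto intro: order_trans[OF Finite_Cartesian_Product.norm_nth_le Finite_Cartesian_Product.norm_nth_le]
           Finite_Cartesian_Product.norm_nth_le)
    finally show ?thesis by simp
  qed
  moreover have "norm (A *v x) \<le> (\<Sum>i\<in>UNIV. norm ((A *v x) $ i))"
    unfolding norm_vec_def[of "A *v x"] by (rule L2_set_le_sum) simp
  ultimately have "norm (A *v x) \<le> (\<Sum>i\<in>(UNIV::'m set). real CARD('n) * (norm A * norm x))"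
    by (meson order_trans sum_mono)
  then show "norm (A *v x) \<le> real (CARD('m) * CARD('n)) * norm A * norm x"
    by (simp add: mult.assoc)
qed simp

instantiation cmatrix :: (finite) real_vector
begin

lift_definition zero_cmatrix :: "'a cmatrix" is 0 .
lift_definition plus_cmatrix :: "'a cmatrix \<Rightarrow> 'a cmatrix \<Rightarrow> 'a cmatrix" is "(+)" .
lift_definition minus_cmatrix :: "'a cmatrix \<Rightarrow> 'a cmatrix \<Rightarrow> 'a cmatrix" is "(-)" .
lift_definition uminus_cmatrix :: "'a cmatrix \<Rightarrow> 'a cmatrix" is uminus .
lift_definition scaleR_cmatrix :: "real \<Rightarrow> 'a cmatrix \<Rightarrow> 'a cmatrix" is scaleR .

instance
  by standard (transfer; simp add: algebra_simps)+

end

instantiation cmatrix :: (finite) real_algebra_1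
begin

lift_definition one_cmatrix :: "'a cmatrix" is "mat 1" .
lift_definition times_cmatrix :: "'a cmatrix \<Rightarrow> 'a cmatrix \<Rightarrow> 'a cmatrix" is "(**)" .

instance
proof
  fix a b c :: "'a cmatrix" and r :: real
  show "a * b * c = a * (b * c)" by transfer (simp add: matrix_mul_assoc)
  show "(a + b) * c = a * c + b * c"
    by transfer (simp add: matrix_matrix_mult_def vec_eq_iff sum.distrib algebra_simps)
  show "a * (b + c) = a * b + a * c" by transfer (simp add: matrix_add_ldistrib)
  show "r *\<^sub>R a * b = r *\<^sub>R (a * b)" "a * r *\<^sub>R b = r *\<^sub>R (a * b)"
    by (transfer, simp add: matrix_matrix_mult_def vec_eq_iff scaleR_sum_right)+
  show "1 * a = a" "a * 1 = a" by (transfer, simp)+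
  show "(0::'a cmatrix) \<noteq> 1" by transfer (simp add: mat_def vec_eq_iff)
qed

end

instantiation cmatrix :: (finite) real_normed_algebra_1
begin

lift_definition norm_cmatrix :: "'a cmatrix \<Rightarrow> real" is "\<lambda>A. onorm ((*v) A)" .
definition sgn_cmatrix :: "'a cmatrix \<Rightarrow> 'a cmatrix" where "sgn_cmatrix a = a /\<^sub>R norm a"
definition dist_cmatrix :: "'a cmatrix \<Rightarrow> 'a cmatrix \<Rightarrow> real"
  where "dist_cmatrix a b = norm (a - b)"
definition uniformity_cmatrix :: "('a cmatrix \<times> 'a cmatrix) filter"
  where "uniformity_cmatrix = (INF e\<in>{0<..}. principal {(x, y). dist x y < e})"
definition open_cmatrix :: "'a cmatrix set \<Rightarrow> bool"
  where "open_cmatrix U \<longleftrightarrow> (\<forall>x\<in>U. \<forall>\<^sub>F (x', y) in uniformity. x' = x \<longrightarrow> y \<in> U)"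

instance
proof
  fix a b :: "'a cmatrix" and r :: real
  show "norm (a + b) \<le> norm a + norm b"
  proof transfer
    fix A B :: "complex^'a^'a"
    have "(*v) (A + B) = (\<lambda>x. A *v x + B *v x)"
      by (auto simp: matrix_vector_mult_add_rdistrib)
    then show "onorm ((*v) (A + B)) \<le> onorm ((*v) A) + onorm ((*v) B)"
      by (simp add: onorm_triangle cmatrix_bounded_linear)
  qed
  show "norm (r *\<^sub>R a) = \<bar>r\<bar> * norm a"
  proof transfer
    fix r and A :: "complex^'a^'a"
    have "(*v) (r *\<^sub>R A) = (\<lambda>x. r *\<^sub>R (A *v x))" by (auto simp: cmatrix_vector_scaleR)
    then show "onorm ((*v) (r *\<^sub>R A)) = \<bar>r\<bar> * onorm ((*v) A)"
      by (simp add: onorm_scaleR cmatrix_bounded_linear)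
  qed
  show "(norm a = 0) = (a = 0)"
  proof transfer
    fix A :: "complex^'a^'a"
    show "(onorm ((*v) A) = 0) = (A = 0)"
      using norm_le_onorm[of A] onorm_le_norm[of A] onorm_pos_le[OF cmatrix_bounded_linear, of A]
      by auto
  qed
  show "norm (a * b) \<le> norm a * norm b"
  proof transfer
    fix A B :: "complex^'a^'a"
    have "(*v) (A ** B) = (*v) A \<circ> (*v) B" by (auto simp: matrix_vector_mul_assoc)
    then show "onorm ((*v) (A ** B)) \<le> onorm ((*v) A) * onorm ((*v) B)"
      by (simp add: onorm_compose cmatrix_bounded_linear)
  qed
  show "norm (1::'a cmatrix) = 1"
  proof transfer
    have "(*v) (mat 1) = (\<lambda>x::complex^'a. x)" by auto
    then show "onorm ((*v) (mat 1 :: complex^'a^'a)) = 1" by (simp add: onorm_id)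
  qed
qed (simp_all add: sgn_cmatrix_def dist_cmatrix_def uniformity_cmatrix_def open_cmatrix_def)

end

instance cmatrix :: (finite) banach
proof
  fix X :: "nat \<Rightarrow> 'a cmatrix"
  assume X: "Cauchy X"
  define K where "K = real (CARD('a) * CARD('a))"
  have K: "K > 0" by (simp add: K_def)
  have le1: "norm (to_vec a - to_vec b) \<le> K * norm (a - b)" for a b :: "'a cmatrix"
    unfolding K_def by transfer (rule norm_le_onorm)
  have le2: "norm (a - b) \<le> K * norm (to_vec a - to_vec b)" for a b :: "'a cmatrix"
    unfolding K_def by transfer (rule onorm_le_norm)
  have "Cauchy (\<lambda>n. to_vec (X n))"
  proof (rule CauchyI)
    fix e :: real assume "e > 0"
    then have "e / K > 0" using K by simp
    then obtain N where N: "\<And>m n. m \<ge> N \<Longrightarrow> n \<ge> N \<Longrightarrow> norm (X m - X n) < e / K"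
      using CauchyD[OF X] by meson
    have "norm (to_vec (X m) - to_vec (X n)) < e" if "m \<ge> N" "n \<ge> N" for m n
      using le1[of "X m" "X n"] N[OF that] K by (simp add: field_simps)
    then show "\<exists>N. \<forall>m\<ge>N. \<forall>n\<ge>N. norm (to_vec (X m) - to_vec (X n)) < e" by blast
  qed
  then obtain L where L: "(\<lambda>n. to_vec (X n)) \<longlonglongrightarrow> L"
    using Cauchy_convergent convergent_def by blast
  have "X \<longlonglongrightarrow> of_vec L"
  proof (rule LIMSEQ_I)
    fix e :: real assume "e > 0"
    then have "e / K > 0" using K by simp
    then obtain N where N: "\<And>n. n \<ge> N \<Longrightarrow> norm (to_vec (X n) - L) < e / K"
      using LIMSEQ_D[OF L] by meson
    have "norm (X n - of_vec L) < e" if "n \<ge> N" for n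
      using le2[of "X n" "of_vec L"] N[OF that] K by (simp add: field_simps of_vec_inverse)
    then show "\<exists>N. \<forall>n\<ge>N. norm (X n - of_vec L) < e" by blast
  qed
  then show "convergent X" by (auto simp: convergent_def)
qed

definition adjoint_matrix :: "complex^'n^'m \<Rightarrow> complex^'m^'n"
  where "adjoint_matrix A = (\<chi> i j. cnj (A $ j $ i))"

lemma adjoint_matrix_adjoint_matrix: "adjoint_matrix (adjoint_matrix A) = A"
  by (simp add: adjoint_matrix_def vec_eq_iff)

lemma inner_adjoint_matrix: "(A *v x) \<bullet> y = x \<bullet> (adjoint_matrix A *v y)"
  for A :: "complex^'n::finite^'m::finite"
proof -
  have inner: "v \<bullet> w = Re (\<Sum>i\<in>UNIV. v $ i * cnj (w $ i))" for v w :: "complex^'k::finite"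
    by (simp add: inner_vec_def inner_complex_def)
  have "(A *v x) \<bullet> y = Re (\<Sum>i\<in>UNIV. \<Sum>j\<in>UNIV. A $ i $ j * x $ j * cnj (y $ i))"
    unfolding inner by (simp add: matrix_vector_mult_def sum_distrib_right)
  also have "\<dots> = Re (\<Sum>j\<in>UNIV. \<Sum>i\<in>UNIV. A $ i $ j * x $ j * cnj (y $ i))"
    by (subst sum.swap) simp
  also have "\<dots> = x \<bullet> (adjoint_matrix A *v y)"
    unfolding inner
    by (simp add: matrix_vector_mult_def adjoint_matrix_def sum_distrib_left cnj_sum mult_ac)
  finally show ?thesis .
qed

lemma cmatrix_cstar_le: "(onorm ((*v) A))\<^sup>2 \<le> onorm ((*v) (adjoint_matrix A ** A))"
  for A :: "complex^'n::finite^'m::finite"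
proof -
  let ?k = "onorm ((*v) (adjoint_matrix A ** A))"
  have k: "?k \<ge> 0" by (rule onorm_pos_le[OF cmatrix_bounded_linear])
  have "onorm ((*v) A) \<le> sqrt ?k"
  proof (rule onorm_bound)
    fix x :: "complex^'n"
    have "(norm (A *v x))\<^sup>2 = x \<bullet> ((adjoint_matrix A ** A) *v x)"
      by (simp add: power2_norm_eq_inner inner_adjoint_matrix matrix_vector_mul_assoc)
    also have "\<dots> \<le> norm x * norm ((adjoint_matrix A ** A) *v x)" by (rule norm_cauchy_schwarz)
    also have "\<dots> \<le> norm x * (?k * norm x)"
      by (intro mult_left_mono cmatrix_norm_mult_vec) simp
    also have "\<dots> = (sqrt ?k * norm x)\<^sup>2" using k by (simp add: power2_eq_square)
    finally show "norm (A *v x) \<le> sqrt ?k * norm x"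
      by (rule power2_le_imp_le) (simp add: k)
  qed (simp add: k)
  then have "(onorm ((*v) A))\<^sup>2 \<le> (sqrt ?k)\<^sup>2"
    by (intro power_mono onorm_pos_le[OF cmatrix_bounded_linear])
  then show ?thesis using k by simp
qed

instantiation cmatrix :: (finite) unital_cstar_algebra
begin

lift_definition scaleC_cmatrix :: "complex \<Rightarrow> 'a cmatrix \<Rightarrow> 'a cmatrix"
  is "\<lambda>c A. \<chi> i j. c * A $ i $ j" .
lift_definition star_cmatrix :: "'a cmatrix \<Rightarrow> 'a cmatrix" is adjoint_matrix .

instance
proof
  fix a b :: "'a cmatrix" and c d :: complex and r :: real
  show "c *\<^sub>C (a + b) = c *\<^sub>C a + c *\<^sub>C b" "(c + d) *\<^sub>C a = c *\<^sub>C a + d *\<^sub>C a"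
    "c *\<^sub>C d *\<^sub>C a = (c * d) *\<^sub>C a"
    by (transfer, simp add: vec_eq_iff algebra_simps)+
  show "complex_of_real r *\<^sub>C a = r *\<^sub>R a"
    by transfer (simp add: vec_eq_iff scaleR_conv_of_real[where 'a=complex])
  show "c *\<^sub>C a * b = c *\<^sub>C (a * b)" "a * c *\<^sub>C b = c *\<^sub>C (a * b)"
    by (transfer, simp add: matrix_matrix_mult_def vec_eq_iff sum_distrib_left mult_ac)+
  show "star (star a) = a" by transfer (rule adjoint_matrix_adjoint_matrix)
  show "star (a + b) = star a + star b" "star (c *\<^sub>C a) = cnj c *\<^sub>C star a"
    by (transfer, simp add: adjoint_matrix_def vec_eq_iff)+
  show star_mult: "star (a * b) = star b * star a" for a b :: "'a cmatrix"
    by transfer (simp add: adjoint_matrix_def matrix_matrix_mult_def vec_eq_iff cnj_sum mult.commute)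
  show "norm (c *\<^sub>C a) = cmod c * norm a"
  proof transfer
    fix c :: complex and A :: "complex^'a^'a"
    have "(\<chi> i j. c * A $ i $ j) *v x = c *s (A *v x)" for x
      by (simp add: vec_eq_iff matrix_vector_mult_def sum_distrib_left mult_ac)
    moreover have "norm (c *s v) = cmod c * norm v" for v :: "complex^'a"
      by (simp add: norm_vec_def norm_mult L2_set_right_distrib)
    ultimately have eq: "norm ((\<chi> i j. c * A $ i $ j) *v x) = norm ((cmod c *\<^sub>R A) *v x)" for x
      by (simp add: cmatrix_vector_scaleR)
    then have "onorm ((*v) (\<chi> i j. c * A $ i $ j)) = onorm ((*v) (cmod c *\<^sub>R A))"
      by (simp add: onorm_def)
    also have "(*v) (cmod c *\<^sub>R A) = (\<lambda>x. cmod c *\<^sub>R (A *v x))"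
      by (auto simp: cmatrix_vector_scaleR)
    also have "onorm \<dots> = cmod c * onorm ((*v) A)"
      by (simp add: onorm_scaleR cmatrix_bounded_linear)
    finally show "onorm ((*v) (\<chi> i j. c * A $ i $ j)) = cmod c * onorm ((*v) A)" .
  qed
  have le: "(norm a)\<^sup>2 \<le> norm (star a * a)" for a :: "'a cmatrix"
    by transfer (rule cmatrix_cstar_le)
  have star_star: "star (star a) = a" for a :: "'a cmatrix"
    by transfer (rule adjoint_matrix_adjoint_matrix)
  have norm_le: "norm a \<le> norm (star a)" for a :: "'a cmatrix"
  proof (cases "norm a = 0")
    case False
    have "norm a * norm a \<le> norm (star a) * norm a"
      using le[of a] norm_mult_ineq[of "star a" a] by (simp add: power2_eq_square)
    then show ?thesis using False by simp
  qed simp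
  have "norm (star a) = norm a"
    using norm_le[of a] norm_le[of "star a"] by (simp add: star_star)
  then show "norm (star a * a) = (norm a)\<^sup>2"
    using le[of a] norm_mult_ineq[of "star a" a] by (simp add: power2_eq_square)
qed

end

end

(*
  Diagonalize a self-adjoint matrix by a unitary (maximizing the Rayleigh quotient on orthogonal
  complements). Conjugating by a permutation matrix permutes the eigenvalues, and averaging the
  eigenvalues with their reversal in increasing order at least halves their spread, which is at
  most 2 * norm a. One such step brings all eigenvalues within norm a / 2 of the midpoint of
  their range. Two steps (four unitaries) bring them within norm (a - t) / 2 of their mean t, as
  the mean is preserved. The mean is the only central element of the Dixmier set: the normalized
  trace is constant on that set and separates the scalars, and it is attained by averaging over
  the signed permutation matrices.
*)

theory Submission
  imports Defs
begin

section \<open>Conjugation by unitaries\<close>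

lemma unitary_star: "u \<in> unitary_group \<Longrightarrow> star u \<in> unitary_group"
  by (simp add: unitary_group_def star_star)

lemma unitary_mult:
  assumes "u \<in> unitary_group" "v \<in> unitary_group"
  shows "u * v \<in> unitary_group"
proof -
  have "star v * (star u * u) * v = 1" "u * (v * star v) * star u = 1"
    using assms by (simp_all add: unitary_group_def)
  then show ?thesis by (simp add: unitary_group_def star_mult mult.assoc)
qed

lemma norm_unitary: "u \<in> unitary_group \<Longrightarrow> norm u = 1"
  using cstar_identity[of u] power2_eq_imp_eq[of "norm u" 1] by (simp add: unitary_group_def)

lemma norm_conj_le:
  assumes "u \<in> unitary_group"
  shows "norm (u * x * star u) \<le> norm x"
proof -
  have "norm (u * x * star u) \<le> norm u * norm x * norm (star u)"
    by (intro order_trans[OF norm_mult_ineq] mult_right_mono norm_mult_ineq) simp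
  then show ?thesis using norm_unitary[OF assms] norm_unitary[OF unitary_star[OF assms]] by simp
qed

text \<open>Conjugation by \<open>star u\<close> undoes conjugation by \<open>u\<close>, and both
  are contractive, so neither can shrink the norm.\<close>

lemma norm_conj:
  assumes "u \<in> unitary_group"
  shows "norm (u * x * star u) = norm x"
proof (rule antisym[OF norm_conj_le[OF assms]])
  have "star u * (u * x * star u) * u = (star u * u) * x * (star u * u)"
    by (simp only: mult.assoc)
  also have "\<dots> = x" using assms by (simp add: unitary_group_def)
  finally have "x = star u * (u * x * star u) * star (star u)" by (simp add: star_star)
  then show "norm x \<le> norm (u * x * star u)"
    using norm_conj_le[OF unitary_star[OF assms], of "u * x * star u"] by simp
qed

section \<open>Monomial and diagonal matrices\<close>

lemma cmatrix_eqI: "(\<And>i j. to_vec a $ i $ j = to_vec b $ i $ j) \<Longrightarrow> a = b"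
  by (simp add: to_vec_inject[symmetric] vec_eq_iff)

lemma times_entry: "to_vec (a * b) $ i $ j = (\<Sum>k\<in>UNIV. to_vec a $ i $ k * to_vec b $ k $ j)"
  by (simp add: times_cmatrix.rep_eq matrix_matrix_mult_def)

lemma one_entry: "to_vec 1 $ i $ j = (if i = j then 1 else 0)"
  by (simp add: one_cmatrix.rep_eq mat_def)

lemma star_entry: "to_vec (star a) $ i $ j = cnj (to_vec a $ j $ i)"
  by (simp add: star_cmatrix.rep_eq adjoint_matrix_def)

lemma scaleR_entry: "to_vec (r *\<^sub>R a) $ i $ j = r *\<^sub>R to_vec a $ i $ j"
  by (simp add: scaleR_cmatrix.rep_eq)

lemma scaleC_entry: "to_vec (c *\<^sub>C a) $ i $ j = c * to_vec a $ i $ j"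
  by (simp add: scaleC_cmatrix.rep_eq)

lemma add_entry: "to_vec (a + b) $ i $ j = to_vec a $ i $ j + to_vec b $ i $ j"
  by (simp add: plus_cmatrix.rep_eq)

lemma diff_entry: "to_vec (a - b) $ i $ j = to_vec a $ i $ j - to_vec b $ i $ j"
  by (simp add: minus_cmatrix.rep_eq)

lemma sum_entry: "to_vec (sum f S) $ i $ j = (\<Sum>x\<in>S. to_vec (f x) $ i $ j)"
  by (induction S rule: infinite_finite_induct) (simp_all add: add_entry zero_cmatrix.rep_eq)

text \<open>One family for two uses: \<open>s = 1\<close> gives the permutation matrices that
  permute eigenvalues, and \<open>s\<close> with values 1 and -1 gives the signed permutation
  matrices that average a matrix to its trace.\<close>

lift_definition monomial_matrix :: "('n \<Rightarrow> complex) \<Rightarrow> ('n \<Rightarrow> 'n) \<Rightarrow> 'n::finite cmatrix"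
  is "\<lambda>s p. \<chi> i j. if j = p i then s i else 0" .

text \<open>The entries are real because they will be the eigenvalues of a self-adjoint matrix,
  which have to be ordered.\<close>

lift_definition diagonal_matrix :: "('n \<Rightarrow> real) \<Rightarrow> 'n::finite cmatrix"
  is "\<lambda>d. \<chi> i j. if i = j then complex_of_real (d i) else 0" .

lemma monomial_entry: "to_vec (monomial_matrix s p) $ i $ j = (if j = p i then s i else 0)"
  by (simp add: monomial_matrix.rep_eq)

lemma diagonal_entry: "to_vec (diagonal_matrix d) $ i $ j = (if i = j then of_real (d i) else 0)"
  by (simp add: diagonal_matrix.rep_eq)

lemma monomial_mult_entry: "to_vec (monomial_matrix s p * a) $ i $ j = s i * to_vec a $ p i $ j"
  by (simp add: times_entry monomial_entry if_distrib[where f="\<lambda>x. x * _"] cong: if_cong)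

lemma monomial_conj_entry:
  "to_vec (monomial_matrix s p * a * star (monomial_matrix s p)) $ i $ j =
    s i * to_vec a $ p i $ p j * cnj (s j)"
  by (simp add: times_entry[of "monomial_matrix s p * a"] monomial_mult_entry star_entry
      monomial_entry if_distrib[where f="\<lambda>x. _ * x"] if_distrib[where f=cnj] cong: if_cong)

text \<open>A one-sided inverse of a square matrix is two-sided, so either of the two unitarity
  equations implies the other.\<close>

lemma cmatrix_left_inverse_unitary:
  fixes u :: "'n::finite cmatrix"
  shows "u * star u = 1 \<Longrightarrow> u \<in> unitary_group"
    and "star u * u = 1 \<Longrightarrow> u \<in> unitary_group"
  by (simp_all add: unitary_group_def to_vec_inject[symmetric] times_cmatrix.rep_eq one_cmatrix.rep_eq
      matrix_left_right_inverse)

lemma monomial_unitary: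
  assumes "bij p" "\<And>i. cmod (s i) = 1"
  shows "monomial_matrix s p \<in> unitary_group"
proof (rule cmatrix_left_inverse_unitary(1), rule cmatrix_eqI)
  fix i j
  have "s i * cnj (s i) = 1" using assms(2) by (simp add: complex_norm_square[symmetric])
  \<comment> \<open>This is the entry formula for conjugation, applied to the identity matrix;
    injectivity of \<open>p\<close> kills the off-diagonal entries.\<close>
  then show "to_vec (monomial_matrix s p * star (monomial_matrix s p)) $ i $ j = to_vec 1 $ i $ j"
    using monomial_conj_entry[of s p 1 i j] assms(1)
    by (auto simp: one_entry dest: bij_is_inj injD)
qed

lemma permutation_conj_diagonal:
  assumes "bij p"
  shows "monomial_matrix (\<lambda>_. 1) p * diagonal_matrix d * star (monomial_matrix (\<lambda>_. 1) p) =
    diagonal_matrix (d \<circ> p)"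
  using assms by (intro cmatrix_eqI) (auto simp: monomial_conj_entry diagonal_entry dest: bij_is_inj injD)

lemma diagonal_diff: "diagonal_matrix d - diagonal_matrix e = diagonal_matrix (\<lambda>i. d i - e i)"
  by (intro cmatrix_eqI) (simp add: diff_entry diagonal_entry)

lemma diagonal_const: "diagonal_matrix (\<lambda>_. r) = r *\<^sub>R 1"
  by (intro cmatrix_eqI) (simp add: scaleR_entry diagonal_entry one_entry scaleR_conv_of_real[where 'a=complex])

lemma sum_diagonal: "(\<Sum>k\<in>K. diagonal_matrix (d k)) = diagonal_matrix (\<lambda>i. \<Sum>k\<in>K. d k i)"
  by (intro cmatrix_eqI) (simp add: sum_entry diagonal_entry)

lemma scaleR_diagonal: "r *\<^sub>R diagonal_matrix d = diagonal_matrix (\<lambda>i. r * d i)"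
  by (intro cmatrix_eqI) (simp add: scaleR_entry diagonal_entry scaleR_conv_of_real[where 'a=complex])

lemma abs_le_norm_diagonal: "\<bar>d i\<bar> \<le> norm (diagonal_matrix d)"
proof -
  have "\<bar>d i\<bar> = cmod (to_vec (diagonal_matrix d) $ i $ i)" by (simp add: diagonal_entry)
  also have "\<dots> \<le> norm (diagonal_matrix d)"
    unfolding norm_cmatrix.rep_eq by (rule norm_entry_le_onorm)
  finally show ?thesis .
qed

text \<open>Coordinate \<open>i\<close> is scaled by \<open>d i\<close>, so Euclidean length grows
  by a factor of at most \<open>b\<close>. With \<open>abs_le_norm_diagonal\<close> this makes the
  norm the largest \<open>\<bar>d i\<bar>\<close>.\<close>

lemma norm_diagonal_le:
  fixes d :: "'n::finite \<Rightarrow> real"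
  assumes "\<And>i. \<bar>d i\<bar> \<le> b"
  shows "norm (diagonal_matrix d) \<le> b"
  unfolding norm_cmatrix.rep_eq
proof (rule onorm_bound)
  \<comment> \<open>The index type is nonempty, and any index will do.\<close>
  show b: "0 \<le> b" using assms[of undefined] by linarith
  fix x :: "complex^'n"
  have "(to_vec (diagonal_matrix d) *v x) $ i = of_real (d i) * x $ i" for i
    by (simp add: matrix_vector_mult_def diagonal_entry if_distrib[where f="\<lambda>x. x * _"] cong: if_cong)
  then have "norm (to_vec (diagonal_matrix d) *v x) \<le> L2_set (\<lambda>i. b * cmod (x $ i)) UNIV"
    unfolding norm_vec_def
    by (intro L2_set_mono) (simp_all add: norm_mult assms mult_right_mono)
  also have "\<dots> = b * norm x" by (simp add: norm_vec_def L2_set_right_distrib b)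
  finally show "norm (to_vec (diagonal_matrix d) *v x) \<le> b * norm x" .
qed

section \<open>The spectral theorem for Hermitian matrices\<close>

text \<open>The inner product \<open>\<bullet>\<close> of the library on complex vectors is
  real-valued, namely the real part of this one. Unitarity of the eigenvector matrix needs complex
  orthogonality.\<close>

definition cinner :: "complex^'n \<Rightarrow> complex^'n \<Rightarrow> complex"
  where "cinner x y = (\<Sum>i\<in>UNIV. x $ i * cnj (y $ i))"

lemma Re_cinner: "Re (cinner x y) = x \<bullet> y"
  by (simp add: cinner_def inner_vec_def inner_complex_def)

text \<open>This recovers the imaginary part from the real inner product: complex orthogonality to
  \<open>y\<close> means real orthogonality to both \<open>y\<close> and
  \<open>\<i> *s y\<close>.\<close>

lemma cinner_ii: "Re (cinner x (\<i> *s y)) = Im (cinner x y)"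
  by (simp add: cinner_def)

lemma cinner_self: "cinner x x = of_real ((norm x)\<^sup>2)"
  by (rule complex_eqI) (simp_all add: Re_cinner power2_norm_eq_inner, simp add: cinner_def)

lemma cinner_commute: "cinner y x = cnj (cinner x y)"
  by (simp add: cinner_def mult.commute)

lemma cinner_adjoint: "cinner (A *v x) y = cinner x (adjoint_matrix A *v y)"
proof -
  have "cinner (A *v x) y = (\<Sum>i\<in>UNIV. \<Sum>j\<in>UNIV. A $ i $ j * x $ j * cnj (y $ i))"
    by (simp add: cinner_def matrix_vector_mult_def sum_distrib_right)
  also have "\<dots> = (\<Sum>j\<in>UNIV. \<Sum>i\<in>UNIV. A $ i $ j * x $ j * cnj (y $ i))"
    by (rule sum.swap)
  also have "\<dots> = cinner x (adjoint_matrix A *v y)"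
    by (simp add: cinner_def matrix_vector_mult_def adjoint_matrix_def sum_distrib_left mult_ac)
  finally show ?thesis .
qed

lemma cinner_add_left: "cinner (x + y) z = cinner x z + cinner y z"
  by (simp add: cinner_def sum.distrib algebra_simps)

lemma cinner_diff_left: "cinner (x - y) z = cinner x z - cinner y z"
  by (simp add: cinner_def sum_subtractf algebra_simps)

lemma cinner_scaleR_left: "cinner (r *\<^sub>R x) z = r *\<^sub>R cinner x z"
  by (simp add: cinner_def scaleR_sum_right)

lemma cinner_scaleR_right: "cinner x (r *\<^sub>R z) = r *\<^sub>R cinner x z"
  by (simp add: cinner_def scaleR_sum_right)

text \<open>Moving from \<open>x\<close> in the direction \<open>- B x\<close> changes the form by
  \<open>-2 * t * (B x \<bullet> B x)\<close> to first order in \<open>t\<close>. Starting from the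
  value 0, it would become negative for small \<open>t > 0\<close> unless \<open>B x = 0\<close>.
  This replaces Lagrange multipliers for the Rayleigh quotient.\<close>

lemma nonneg_form_kernel:
  fixes B :: "'a::real_inner \<Rightarrow> 'a"
  assumes "linear B" and sym: "\<And>y z. B y \<bullet> z = y \<bullet> B z"
    and W: "subspace W" "\<And>y. y \<in> W \<Longrightarrow> B y \<in> W"
    and nonneg: "\<And>y. y \<in> W \<Longrightarrow> 0 \<le> B y \<bullet> y"
    and x: "x \<in> W" "B x \<bullet> x = 0"
  shows "B x = 0"
proof (rule ccontr)
  interpret linear B by fact
  assume "B x \<noteq> 0"
  then have p: "0 < B x \<bullet> B x" by simp
  define c where "c = B (B x) \<bullet> B x"
  \<comment> \<open>Adding 1 keeps the denominator positive even if \<open>c = 0\<close>, and still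
    makes the quadratic term smaller than the linear one.\<close>
  define t where "t = (B x \<bullet> B x) / (c + 1)"
  have c: "0 \<le> c" using nonneg W(2) x(1) by (simp add: c_def)
  have "0 < t" using p c by (simp add: t_def)
  moreover have "t * c \<le> B x \<bullet> B x" using p c by (simp add: t_def field_simps)
  ultimately have t: "0 < t" "t * c < 2 * (B x \<bullet> B x)" using p by linarith+
  have "x - t *\<^sub>R B x \<in> W" using W x by (simp add: subspace_diff subspace_scale)
  then have "0 \<le> B (x - t *\<^sub>R B x) \<bullet> (x - t *\<^sub>R B x)" by (rule nonneg)
  also have "\<dots> = t * (t * c - 2 * (B x \<bullet> B x))"
    using x(2) sym[of "B x" x] by (simp add: diff scale inner_diff c_def algebra_simps)
  finally show False using t by (simp add: zero_le_mult_iff)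
qed

text \<open>A maximizer of the Rayleigh quotient on the unit sphere of the orthogonal complement
  \<open>W\<close> of \<open>E\<close> is an eigenvector, because \<open>A\<close> leaves
  \<open>W\<close> invariant.\<close>

lemma eigenvector_orthogonal_to_eigenvectors:
  fixes A :: "complex^'n::finite^'n"
  assumes A: "adjoint_matrix A = A"
    and E: "finite E" "card E < CARD('n)" "\<And>e. e \<in> E \<Longrightarrow> \<exists>r::real. A *v e = r *\<^sub>R e"
  shows "\<exists>x. norm x = 1 \<and> (\<forall>e\<in>E. cinner x e = 0) \<and> (\<exists>r::real. A *v x = r *\<^sub>R x)"
proof -
  define W where "W = {x. \<forall>e\<in>E. cinner x e = 0}"
  have sub: "subspace W"
    by (auto simp: W_def subspace_def cinner_add_left cinner_scaleR_left) (simp add: cinner_def)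
  have cont: "continuous_on UNIV (\<lambda>x. cinner x e)" for e :: "complex^'n"
    unfolding cinner_def by (intro continuous_intros)
  have "W = (\<Inter>e\<in>E. {x. cinner x e = 0})" by (auto simp: W_def)
  then have "closed W" by (auto intro!: closed_INT closed_Collect_eq cont)
  then have compact: "compact (W \<inter> sphere 0 1)" by (simp add: closed_Int_compact)
  \<comment> \<open>The dimension count is real: a vector of \<open>W\<close> is one that is
    real-orthogonal to these at most \<open>2 * card E\<close> vectors, fewer than the real
    dimension \<open>2 * CARD('n)\<close>.\<close>
  let ?E = "E \<union> (\<lambda>e. \<i> *s e) ` E"
  have "dim (span ?E) \<le> card ?E" using E(1) by (simp add: dim_le_card')
  also have "\<dots> \<le> card E + card E"
    using card_Un_le[of E "(\<lambda>e. \<i> *s e) ` E"] card_image_le[OF E(1), of "\<lambda>e. \<i> *s e"] by linarith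
  also have "\<dots> < DIM(complex^'n)" using E(2) by simp
  finally obtain w where w: "w \<noteq> 0" "\<And>y. y \<in> span ?E \<Longrightarrow> orthogonal w y"
    using orthogonal_to_subspace_exists[of "span ?E"] by (metis dim_span orthogonal_to_subspace_exists)
  have "w \<in> W" unfolding W_def
  proof safe
    fix e assume "e \<in> E"
    then have "w \<bullet> e = 0" "w \<bullet> (\<i> *s e) = 0"
      using w(2) by (auto simp: orthogonal_def span_base)
    then show "cinner w e = 0"
      by (intro complex_eqI) (simp_all add: Re_cinner cinner_ii[symmetric])
  qed
  then have "(1 / norm w) *\<^sub>R w \<in> W \<inter> sphere 0 1"
    using sub w(1) by (simp add: subspace_scale)
  then have ne: "W \<inter> sphere 0 1 \<noteq> {}" by blast
  have "continuous_on (W \<inter> sphere 0 1) (\<lambda>x. (A *v x) \<bullet> x)"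
    by (intro continuous_intros linear_continuous_on cmatrix_bounded_linear)
  then obtain x where x: "x \<in> W" "norm x = 1"
      and max: "\<And>y. y \<in> W \<Longrightarrow> norm y = 1 \<Longrightarrow> (A *v y) \<bullet> y \<le> (A *v x) \<bullet> x"
    using continuous_attains_sup[OF compact ne] by fastforce
  define r where "r = (A *v x) \<bullet> x"
  \<comment> \<open>As \<open>r\<close> is the maximum of the Rayleigh quotient on \<open>W\<close>,
    the form of \<open>r - A\<close> is nonnegative on \<open>W\<close> and vanishes at
    \<open>x\<close>.\<close>
  define B where "B = (\<lambda>y. r *\<^sub>R y - A *v y)"
  have "B x = 0"
  proof (rule nonneg_form_kernel[where B=B and W=W, OF _ _ sub])
    show "linear B" unfolding B_def
      by (intro linear_compose_sub linear_scale_self bounded_linear.linear cmatrix_bounded_linear)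
    show "B y \<bullet> z = y \<bullet> B z" for y z
      using inner_adjoint_matrix[of A y z] A by (simp add: B_def inner_diff)
    \<comment> \<open>Self-adjointness moves \<open>A\<close> over to \<open>e\<close>, where it
      acts as a real scalar, so orthogonality to \<open>e\<close> survives.\<close>
    show "B y \<in> W" if "y \<in> W" for y unfolding W_def
    proof safe
      fix e assume e: "e \<in> E"
      then obtain s :: real where s: "A *v e = s *\<^sub>R e" using E(3) by blast
      have "cinner y e = 0" using e that by (simp add: W_def)
      then show "cinner (B y) e = 0"
        by (simp add: B_def cinner_diff_left cinner_scaleR_left cinner_adjoint A s cinner_scaleR_right)
    qed
    show "0 \<le> B y \<bullet> y" if y: "y \<in> W" for y
    proof (cases "y = 0")
      case False
      let ?y = "(1 / norm y) *\<^sub>R y"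
      have "(A *v ?y) \<bullet> ?y \<le> r" unfolding r_def
        using y sub False by (intro max) (auto simp: subspace_scale)
      moreover have "A *v ?y = (1 / norm y) *\<^sub>R (A *v y)"
        by (rule linear_scale[OF bounded_linear.linear[OF cmatrix_bounded_linear]])
      ultimately have "(A *v y) \<bullet> y \<le> r * (norm y)\<^sup>2"
        using False by (simp add: field_simps power2_eq_square)
      then show ?thesis by (simp add: B_def inner_diff power2_norm_eq_inner)
    qed (simp add: B_def)
    show "B x \<bullet> x = 0" using x by (simp add: B_def inner_diff r_def power2_norm_eq_inner[symmetric])
  qed (rule x(1))
  then show ?thesis using x by (auto simp: B_def W_def intro!: exI[of _ x] exI[of _ r])
qed

text \<open>Induction on \<open>k\<close>. A unit vector orthogonal to \<open>E\<close> is not in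
  \<open>E\<close>, so inserting the next eigenvector raises the cardinality;
  \<open>k = CARD('n)\<close> gives an orthonormal eigenbasis.\<close>

lemma orthonormal_eigenvectors:
  fixes A :: "complex^'n::finite^'n"
  assumes "adjoint_matrix A = A" "k \<le> CARD('n)"
  shows "\<exists>E. finite E \<and> card E = k \<and> (\<forall>e\<in>E. norm e = 1 \<and> (\<exists>r::real. A *v e = r *\<^sub>R e)) \<and>
    (\<forall>e\<in>E. \<forall>f\<in>E. e \<noteq> f \<longrightarrow> cinner e f = 0)"
  using assms(2)
proof (induction k)
  case (Suc k)
  then obtain E where E: "finite E" "card E = k"
      "\<forall>e\<in>E. norm e = 1 \<and> (\<exists>r::real. A *v e = r *\<^sub>R e)"
      "\<forall>e\<in>E. \<forall>f\<in>E. e \<noteq> f \<longrightarrow> cinner e f = 0"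
    by auto
  obtain x where x: "norm x = 1" "\<forall>e\<in>E. cinner x e = 0" "\<exists>r::real. A *v x = r *\<^sub>R x"
    using eigenvector_orthogonal_to_eigenvectors[OF assms(1) E(1)] E Suc.prems by auto
  have "x \<notin> E" using x by (auto simp: cinner_self)
  moreover have "\<forall>e\<in>E. cinner e x = 0" using x(2) cinner_commute[of _ x] by simp
  ultimately show ?case
    using E x by (intro exI[of _ "insert x E"]) auto
qed (rule exI[of _ "{}"], simp)

text \<open>The columns of \<open>u\<close> form an orthonormal eigenbasis: orthonormality says
  \<open>star u * u = 1\<close>, and the eigenvector equations, read column by column, say
  \<open>a * u = u * diagonal_matrix d\<close>.\<close>

theorem selfadjoint_diagonalizable:
  fixes a :: "'n::finite cmatrix"
  assumes "selfadjoint a"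
  shows "\<exists>u\<in>unitary_group. \<exists>d. a = u * diagonal_matrix d * star u"
proof -
  let ?A = "to_vec a"
  have "adjoint_matrix ?A = ?A"
    using assms by (simp add: selfadjoint_def star_cmatrix.rep_eq[symmetric])
  from orthonormal_eigenvectors[OF this order_refl] obtain E where E: "finite E" "card E = CARD('n)"
      "\<forall>e\<in>E. norm e = 1 \<and> (\<exists>r::real. ?A *v e = r *\<^sub>R e)"
      "\<forall>e\<in>E. \<forall>f\<in>E. e \<noteq> f \<longrightarrow> cinner e f = 0"
    by blast
  obtain e where e: "bij_betw e (UNIV :: 'n set) E"
    using finite_same_card_bij[of "UNIV :: 'n set" E] E by auto
  have eE: "e k \<in> E" for k using e by (auto simp: bij_betw_def)
  then have "\<forall>k. \<exists>r::real. ?A *v e k = r *\<^sub>R e k" using E(3) by blast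
  then obtain d :: "'n \<Rightarrow> real" where d: "\<And>k. ?A *v e k = d k *\<^sub>R e k" by metis
  have orth: "cinner (e k) (e l) = (if k = l then 1 else 0)" for k l
    using E(3,4) eE bij_betw_imp_inj_on[OF e] by (auto simp: cinner_self inj_eq)
  define u where "u = of_vec (\<chi> i k. e k $ i)"
  have u: "to_vec u $ i $ k = e k $ i" for i k by (simp add: u_def of_vec_inverse)
  have "star u * u = 1"
  proof (rule cmatrix_eqI)
    fix i j
    \<comment> \<open>The star conjugates the left factor, so this entry is
      \<open>cinner (e j) (e i)\<close>, with the indices swapped.\<close>
    show "to_vec (star u * u) $ i $ j = to_vec 1 $ i $ j"
      using orth[of j i] by (simp add: times_entry star_entry u one_entry cinner_def mult.commute)
  qed
  then have uU: "u \<in> unitary_group" by (rule cmatrix_left_inverse_unitary)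
  have "a * u = u * diagonal_matrix d"
  proof (rule cmatrix_eqI)
    fix i k
    have "to_vec (a * u) $ i $ k = (?A *v e k) $ i"
      by (simp add: times_entry u matrix_vector_mult_def)
    also have "\<dots> = to_vec (u * diagonal_matrix d) $ i $ k"
      by (simp add: d times_entry u diagonal_entry scaleR_conv_of_real[where 'a=complex] mult.commute
          if_distrib[where f="\<lambda>x. _ * x"] cong: if_cong)
    finally show "to_vec (a * u) $ i $ k = to_vec (u * diagonal_matrix d) $ i $ k" .
  qed
  then have "u * diagonal_matrix d * star u = a * (u * star u)" by (metis mult.assoc)
  then show ?thesis using uU by (intro bexI[of _ u] exI[of _ d]) (auto simp: unitary_group_def)
qed

section \<open>The centre-valued trace\<close>

definition normalized_trace :: "'n::finite cmatrix \<Rightarrow> complex"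
  where "normalized_trace a = (\<Sum>i\<in>UNIV. to_vec a $ i $ i) / of_nat CARD('n)"

lemma normalized_trace_mult_commute: "normalized_trace (a * b) = normalized_trace (b * a)"
proof -
  have "(\<Sum>i\<in>UNIV. to_vec (a * b) $ i $ i) = (\<Sum>i\<in>UNIV. to_vec (b * a) $ i $ i)"
    unfolding times_entry by (subst sum.swap) (simp add: mult.commute)
  then show ?thesis by (simp add: normalized_trace_def)
qed

lemma normalized_trace_conj:
  "u \<in> unitary_group \<Longrightarrow> normalized_trace (u * a * star u) = normalized_trace a"
  by (subst normalized_trace_mult_commute)
    (simp add: unitary_group_def mult.assoc[symmetric])

lemma normalized_trace_scaleC_one: "normalized_trace (c *\<^sub>C 1) = c"
  by (simp add: normalized_trace_def scaleC_entry one_entry)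

lemma normalized_trace_diagonal:
  "normalized_trace (diagonal_matrix d :: 'n::finite cmatrix) =
    of_real ((\<Sum>i\<in>UNIV. d i) / real CARD('n))"
  by (simp add: normalized_trace_def diagonal_entry)

lemma linear_normalized_trace: "linear normalized_trace"
  by (intro linearI) (simp_all add: normalized_trace_def add_entry scaleR_entry sum.distrib
      add_divide_distrib sum_distrib_left[symmetric] scaleR_conv_of_real[where 'a=complex])

text \<open>Each diagonal entry is at most the operator norm. Continuity is what lets the trace pass
  to the closure in the Dixmier set.\<close>

lemma bounded_linear_normalized_trace: "bounded_linear normalized_trace"
proof (rule bounded_linear_intro[where K=1])
  fix a :: "'n::finite cmatrix"
  have "cmod (\<Sum>i\<in>UNIV. to_vec a $ i $ i) \<le> (\<Sum>i\<in>(UNIV::'n set). norm a)"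
    unfolding norm_cmatrix.rep_eq by (intro sum_norm_le norm_entry_le_onorm)
  then show "norm (normalized_trace a) \<le> norm a * 1"
    by (simp add: normalized_trace_def norm_divide field_simps)
qed (simp_all add: linear_add[OF linear_normalized_trace] linear_scale[OF linear_normalized_trace])

text \<open>A level set of the trace is closed and convex, and it contains the unitary orbit of each
  of its elements.\<close>

lemma dixmier_set_trace:
  assumes "z \<in> dixmier_set a"
  shows "normalized_trace z = normalized_trace a"
proof -
  let ?S = "normalized_trace -` {normalized_trace a}"
  have "closed ?S"
    by (intro closed_vimage closed_singleton
        linear_continuous_on[OF bounded_linear_normalized_trace])
  moreover have "convex ?S"
    by (rule convex_linear_vimage[OF linear_normalized_trace convex_singleton])
  moreover have "{u * a * star u | u. u \<in> unitary_group} \<subseteq> ?S"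
    by (auto simp: normalized_trace_conj)
  ultimately have "dixmier_set a \<subseteq> ?S"
    unfolding dixmier_set_def by (intro closure_minimal hull_minimal)
  then show ?thesis using assms by auto
qed

lemma scaleC_one_centre: "c *\<^sub>C 1 \<in> centre"
  by (simp add: centre_def mult_scaleC_left mult_scaleC_right)

lemma scaleR_one_centre: "r *\<^sub>R 1 \<in> centre"
  by (simp add: centre_def)

lemma cmatrix_centre_scalar:
  fixes z :: "'n::finite cmatrix"
  assumes "z \<in> centre"
  shows "\<exists>c. z = c *\<^sub>C 1"
proof -
  have entry: "to_vec z $ i $ j = (if i = j then to_vec z $ k $ k else 0)" for i j k
  proof -
    \<comment> \<open>The matrix unit with its 1 at \<open>(j, k)\<close>. Entry
      \<open>(i, k)\<close> of \<open>z * e\<close> is \<open>z\<close> at \<open>(i, j)\<close>;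
      that of \<open>e * z\<close> is \<open>z\<close> at \<open>(k, k)\<close> if
      \<open>i = j\<close> and 0 otherwise. One comparison thus settles both off-diagonal and
      diagonal entries.\<close>
    define e where "e = of_vec (\<chi> x y. if x = j \<and> y = k then (1::complex) else 0)"
    have e: "to_vec e $ x $ y = (if x = j then if y = k then 1 else 0 else 0)" for x y
      by (simp add: e_def of_vec_inverse)
    have "to_vec (z * e) $ i $ k = to_vec (e * z) $ i $ k"
      using assms by (simp add: centre_def)
    then show ?thesis
      by (auto simp: times_entry e if_distrib[where f="\<lambda>x. _ * x"] if_distrib[where f="\<lambda>x. x * _"]
          cong: if_cong)
  qed
  show ?thesis
    by (intro exI[of _ "to_vec z $ undefined $ undefined"] cmatrix_eqI)
      (subst entry[of _ _ undefined], simp add: scaleC_entry one_entry)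
qed

text \<open>Averaging over the finite group of signed permutation matrices: the signs kill the
  off-diagonal entries, and the permutations make the diagonal entries equal.\<close>

lemma trace_in_dixmier_set:
  fixes a :: "'n::finite cmatrix"
  shows "normalized_trace a *\<^sub>C 1 \<in> dixmier_set a"
proof -
  define sg :: "('n \<Rightarrow> bool) \<Rightarrow> 'n \<Rightarrow> complex" where "sg = (\<lambda>s i. if s i then 1 else - 1)"
  define G where "G = (UNIV :: ('n \<Rightarrow> bool) set) \<times> {p :: 'n \<Rightarrow> 'n. bij p}"
  define m where "m = (\<lambda>(s, p). monomial_matrix (sg s) p)"
  define N where "N = real CARD('n \<Rightarrow> bool)"
  define P where "P = real (card {p :: 'n \<Rightarrow> 'n. bij p})"
  have "{p :: 'n \<Rightarrow> 'n. bij p} \<noteq> {}" using bij_id by blast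
  then have NP: "N > 0" "P > 0"
    by (simp_all add: N_def P_def card_gt_0_iff del: card_fun)
  have m: "m g \<in> unitary_group" if "g \<in> G" for g
    using that by (auto simp: G_def m_def sg_def intro!: monomial_unitary)
  let ?x = "\<Sum>g\<in>G. (1 / (N * P)) *\<^sub>R (m g * a * star (m g))"
  have "?x \<in> convex hull {u * a * star u | u. u \<in> unitary_group}"
  proof (rule convex_sum[OF _ convex_convex_hull])
    show "finite G" by (simp add: G_def)
    show "(\<Sum>g\<in>G. 1 / (N * P)) = 1"
    proof -
      have "real (card G) = N * P"
        by (simp only: G_def N_def P_def card_cartesian_product of_nat_mult)
      then show ?thesis using NP by simp
    qed
    show "0 \<le> 1 / (N * P)" using NP by simp
    show "m g * a * star (m g) \<in> convex hull {u * a * star u | u. u \<in> unitary_group}" if "g \<in> G" for g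
      by (rule hull_inc) (use m[OF that] in blast)
  qed
  then have "?x \<in> dixmier_set a" unfolding dixmier_set_def by (rule closure_subset[THEN subsetD])
  moreover have "?x = normalized_trace a *\<^sub>C 1"
  proof (rule cmatrix_eqI)
    fix i j
    have signs: "(\<Sum>s\<in>UNIV. sg s i * cnj (sg s j)) = (if i = j then of_real N else 0)"
    proof (cases "i = j")
      case True
      then show ?thesis by (simp add: sg_def N_def if_distrib cong: if_cong del: card_fun)
    next
      case False
      \<comment> \<open>Flipping the sign at \<open>i\<close> permutes the sign patterns and negates
        every term, so the sum equals its own negative.\<close>
      let ?flip = "\<lambda>s. s(i := \<not> s i)"
      have "bij ?flip" by (rule o_bij[of ?flip]) auto
      then have "(\<Sum>s\<in>UNIV. sg s i * cnj (sg s j)) = (\<Sum>s\<in>UNIV. sg (?flip s) i * cnj (sg (?flip s) j))"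
        by (rule sum.reindex_bij_betw[symmetric])
      also have "\<dots> = - (\<Sum>s\<in>UNIV. sg s i * cnj (sg s j))"
        unfolding sum_negf[symmetric] using False by (intro sum.cong) (auto simp: sg_def)
      finally show ?thesis using False by simp
    qed
    define D where "D = (\<lambda>k :: 'n. \<Sum>p | bij p. to_vec a $ p k $ p k)"
    have perm: "D k = D i" for k
    proof -
      \<comment> \<open>Precomposition with the transposition of \<open>i\<close> and
        \<open>k\<close> reindexes the permutations and turns \<open>p k\<close> into
        \<open>p i\<close>.\<close>
      have "bij_betw (\<lambda>p. p \<circ> Transposition.transpose i k) {p. bij p} {p :: 'n \<Rightarrow> 'n. bij p}"
        by (rule bij_betw_byWitness[where f'="\<lambda>p. p \<circ> Transposition.transpose i k"])
          (auto simp: comp_assoc intro: bij_comp)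
      then have "D k = (\<Sum>p | bij p. to_vec a $ (p \<circ> Transposition.transpose i k) k
          $ (p \<circ> Transposition.transpose i k) k)"
        unfolding D_def by (rule sum.reindex_bij_betw[symmetric])
      then show ?thesis by (simp add: D_def)
    qed
    \<comment> \<open>Summed over all \<open>k\<close>, each of the \<open>P\<close> permutations
      contributes the full trace; this fixes the common value of the \<open>D k\<close>.\<close>
    have "of_nat CARD('n) * D i = (\<Sum>k\<in>(UNIV :: 'n set). D i)" by simp
    also have "\<dots> = (\<Sum>k\<in>UNIV. D k)" by (intro sum.cong refl perm[symmetric])
    also have "\<dots> = (\<Sum>p :: 'n \<Rightarrow> 'n | bij p. \<Sum>k\<in>UNIV. to_vec a $ p k $ p k)"
      unfolding D_def by (rule sum.swap)
    also have "\<dots> = (\<Sum>p :: 'n \<Rightarrow> 'n | bij p. \<Sum>k\<in>UNIV. to_vec a $ k $ k)"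
      by (intro sum.cong refl sum.reindex_bij_betw[where g="\<lambda>k. to_vec a $ k $ k"]) simp
    finally have D: "D i = of_real P * normalized_trace a"
      by (simp add: normalized_trace_def P_def field_simps)
    have "to_vec ?x $ i $ j = (\<Sum>g\<in>G. (1 / (N * P)) *\<^sub>R to_vec (m g * a * star (m g)) $ i $ j)"
      by (simp add: sum_entry scaleR_entry)
    also have "\<dots> = (\<Sum>s\<in>UNIV. \<Sum>p | bij p. of_real (1 / (N * P)) *
        (sg s i * cnj (sg s j) * to_vec a $ p i $ p j))"
      by (simp add: G_def sum.cartesian_product m_def monomial_conj_entry scaleR_conv_of_real
          mult_ac[where 'a=complex] case_prod_unfold)
    \<comment> \<open>Signs and permutations vary independently, so the double sum factors.\<close>
    also have "\<dots> = of_real (1 / (N * P)) * ((\<Sum>s\<in>UNIV. sg s i * cnj (sg s j)) *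
        (\<Sum>p | bij p. to_vec a $ p i $ p j))"
      by (subst sum_product) (simp only: sum_distrib_left)
    also have "\<dots> = to_vec (normalized_trace a *\<^sub>C 1) $ i $ j"
      unfolding signs using NP D by (cases "i = j") (simp_all add: scaleC_entry one_entry D_def)
    finally show "to_vec ?x $ i $ j = to_vec (normalized_trace a *\<^sub>C 1) $ i $ j" .
  qed
  ultimately show ?thesis by simp
qed

text \<open>A central element is a scalar, which its trace determines, and the trace is constant on
  the Dixmier set.\<close>

lemma dixmier_set_centre:
  fixes a :: "'n::finite cmatrix"
  shows "dixmier_set a \<inter> centre = {normalized_trace a *\<^sub>C 1}"
proof -
  have "z = normalized_trace a *\<^sub>C 1" if "z \<in> dixmier_set a" "z \<in> centre" for z
    using cmatrix_centre_scalar[OF that(2)] dixmier_set_trace[OF that(1)]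
    by (auto simp: normalized_trace_scaleC_one)
  then show ?thesis using trace_in_dixmier_set scaleC_one_centre by blast
qed

lemma centre_trace_cmatrix: "centre_trace (a :: 'n::finite cmatrix) = normalized_trace a *\<^sub>C 1"
  by (simp add: centre_trace_def dixmier_set_centre)

section \<open>Averaging eigenvalues\<close>

text \<open>The index type carries no order of its own, so positions by increasing value of
  \<open>d\<close> are supplied from outside.\<close>

lemma sorted_enumeration:
  fixes d :: "'n::finite \<Rightarrow> 'a::linorder"
  shows "\<exists>e. bij_betw e {..<CARD('n)} UNIV \<and> (\<forall>k l. k \<le> l \<longrightarrow> l < CARD('n) \<longrightarrow> d (e k) \<le> d (e l))"
proof -
  obtain xs where xs: "set xs = (UNIV :: 'n set)" "distinct xs"
    using finite_distinct_list[of "UNIV :: 'n set"] by auto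
  define ys where "ys = sort_key d xs"
  have ys: "set ys = UNIV" "distinct ys" "length ys = CARD('n)"
    using xs distinct_card[OF xs(2)] by (simp_all add: ys_def)
  have "bij_betw ((!) ys) {..<CARD('n)} UNIV"
    using bij_betw_nth[OF ys(2)] ys by simp
  moreover have "sorted (map d ys)" by (simp add: ys_def)
  then have "d (ys ! k) \<le> d (ys ! l)" if "k \<le> l" "l < CARD('n)" for k l
    using that ys(3) sorted_nth_mono[of "map d ys" k l] by simp
  ultimately show ?thesis by blast
qed

text \<open>The sorted list is read backwards. Indices with equal values of \<open>d\<close> occupy
  arbitrary positions among themselves, so only strict inequalities are reversed.\<close>

lemma order_reversing_permutation:
  fixes d :: "'n::finite \<Rightarrow> 'a::linorder"
  shows "\<exists>p. bij p \<and> (\<forall>i j. d i < d j \<longrightarrow> d (p j) \<le> d (p i))"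
proof -
  let ?I = "{..<CARD('n)}"
  obtain e where e: "bij_betw e ?I (UNIV :: 'n set)"
      and mono: "\<And>k l. k \<le> l \<Longrightarrow> l < CARD('n) \<Longrightarrow> d (e k) \<le> d (e l)"
    using sorted_enumeration[of d] by blast
  \<comment> \<open>Positions run from 0 to \<open>CARD('n) - 1\<close>; \<open>r\<close> reflects
    them.\<close>
  define r where "r k = CARD('n) - 1 - k" for k
  define p where "p = e \<circ> r \<circ> inv_into ?I e"
  have r: "bij_betw r ?I ?I"
    by (rule bij_betw_byWitness[where f'=r]) (auto simp: r_def)
  have "bij p" unfolding p_def
    by (intro bij_betw_trans[OF _ bij_betw_trans[OF r e]] bij_betw_inv_into e)
  moreover have "d (p j) \<le> d (p i)" if "d i < d j" for i j
  proof -
    let ?k = "inv_into ?I e"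
    have k: "?k x < CARD('n)" "e (?k x) = x" for x
      using bij_betw_inv_into_right[OF e, of x] bij_betw_inv_into[OF e]
      by (auto simp: bij_betw_def)
    have "?k i \<le> ?k j" using mono[of "?k j" "?k i"] k that by (metis leD linear)
    then have "d (e (r (?k j))) \<le> d (e (r (?k i)))"
      by (intro mono) (auto simp: r_def)
    then show ?thesis by (simp add: p_def)
  qed
  ultimately show ?thesis by blast
qed

text \<open>For an order-reversing \<open>p\<close> the differences \<open>d i - d j\<close> and
  \<open>d (p i) - d (p j)\<close> never have the same strict sign unless the first is 0, so their
  sum is at most the larger of them or the second alone, hence at most \<open>s\<close>.\<close>

lemma halve_spread:
  fixes d :: "'n::finite \<Rightarrow> real"
  assumes "\<And>i j. d i - d j \<le> s"
  shows "\<exists>p. bij p \<and> (\<forall>i j. (d i + d (p i)) / 2 - (d j + d (p j)) / 2 \<le> s / 2)"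
proof -
  obtain p where p: "bij p" "\<And>i j. d i < d j \<Longrightarrow> d (p j) \<le> d (p i)"
    using order_reversing_permutation[of d] by blast
  have "(d i + d (p i)) / 2 - (d j + d (p j)) / 2 \<le> s / 2" for i j
    using assms[of i j] assms[of "p i" "p j"] assms[of i i] p(2)[of i j] p(2)[of j i]
    by (cases "d i" "d j" rule: linorder_cases) (auto simp: field_simps)
  then show ?thesis using p(1) by blast
qed

text \<open>Conjugating a permutation matrix by \<open>u\<close> makes it permute the eigenvectors.
  The averages of \<open>a\<close> then stay diagonal in its eigenbasis, and only tuples of real
  eigenvalues remain to be studied.\<close>

lemma unitary_average_permutations:
  assumes u: "u \<in> unitary_group" and p: "\<And>k. k \<in> {1..m} \<Longrightarrow> bij (p k)"
  shows "\<exists>v. (\<forall>k\<in>{1..m}. v k \<in> unitary_group) \<and>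
    unitary_average m v (u * diagonal_matrix d * star u) =
      u * diagonal_matrix (\<lambda>i. (\<Sum>k=1..m. d (p k i)) / real m) * star u"
proof -
  define q where "q k = monomial_matrix (\<lambda>_. 1) (p k)" for k
  define v where "v k = u * q k * star u" for k
  have q: "q k \<in> unitary_group" if "k \<in> {1..m}" for k
    using p[OF that] by (simp add: q_def monomial_unitary)
  have conj: "v k * (u * diagonal_matrix d * star u) * star (v k) =
      u * diagonal_matrix (d \<circ> p k) * star u" if "k \<in> {1..m}" for k
  proof -
    have "v k * (u * diagonal_matrix d * star u) * star (v k) =
        u * q k * (star u * u) * diagonal_matrix d * (star u * u) * star (q k) * star u"
      by (simp add: v_def star_mult star_star mult.assoc)
    also have "\<dots> = u * (q k * diagonal_matrix d * star (q k)) * star u"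
      using u by (simp add: unitary_group_def mult.assoc)
    finally show ?thesis
      by (simp add: q_def permutation_conj_diagonal[OF p[OF that]])
  qed
  have "unitary_average m v (u * diagonal_matrix d * star u) =
      (\<Sum>k=1..m. u * ((1 / real m) *\<^sub>R diagonal_matrix (d \<circ> p k)) * star u)"
    unfolding unitary_average_def by (intro sum.cong refl) (simp add: conj)
  also have "\<dots> = u * diagonal_matrix (\<lambda>i. (\<Sum>k=1..m. d (p k i)) / real m) * star u"
    by (simp only: sum_distrib_left[symmetric] sum_distrib_right[symmetric])
      (simp add: sum_diagonal scaleR_diagonal sum_divide_distrib)
  finally show ?thesis
    using u q by (intro exI[of _ v]) (simp add: v_def unitary_mult unitary_star)
qed

text \<open>Unitary conjugation fixes scalars, so the distance to a scalar can be read off the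
  shifted eigenvalues.\<close>

lemma conj_diagonal_diff_scalar:
  assumes "u \<in> unitary_group"
  shows "u * diagonal_matrix d * star u - r *\<^sub>R 1 =
    u * diagonal_matrix (\<lambda>i. d i - r) * star u"
proof -
  have "u * diagonal_matrix (\<lambda>i. d i - r) * star u = u * (diagonal_matrix d - r *\<^sub>R 1) * star u"
    by (simp add: diagonal_diff[symmetric] diagonal_const)
  then show ?thesis using assms by (simp add: unitary_group_def algebra_simps)
qed

section \<open>The constants for the two uniform properties\<close>

theorem uniform_dixmier_cmatrix: "uniform_dixmier_property TYPE('n::finite cmatrix) 2 (1 / 2)"
proof -
  have "\<exists>z\<in>centre. \<exists>v. (\<forall>k\<in>{1..2}. v k \<in> unitary_group) \<and>
      norm (unitary_average 2 v a - z) \<le> 1 / 2 * norm a"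
    if sa: "selfadjoint a" for a :: "'n cmatrix"
  proof -
    obtain u d where u: "u \<in> unitary_group" and a: "a = u * diagonal_matrix d * star u"
      using selfadjoint_diagonalizable[OF sa] by blast
    have "\<bar>d i\<bar> \<le> norm a" for i
      using abs_le_norm_diagonal[of d i] by (simp add: a norm_conj[OF u])
    then have "d i - d j \<le> 2 * norm a" for i j using abs_le_D1 abs_le_D2 by (smt (verit))
    from halve_spread[of d, OF this] obtain p where p: "bij p"
        "\<And>i j. (d i + d (p i)) / 2 - (d j + d (p j)) / 2 \<le> norm a" by auto
    define b where "b i = (d i + d (p i)) / 2" for i
    \<comment> \<open>The midpoint of the range is within half the spread of every value; the mean
      need not be.\<close>
    define r where "r = (Max (range b) + Min (range b)) / 2"
    obtain i j where ij: "Max (range b) = b i" "Min (range b) = b j"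
      using Max_in[of "range b"] Min_in[of "range b"] by (metis UNIV_not_empty finite
          finite_imageI image_is_empty imageE)
    have bnd: "b k \<le> Max (range b)" "Min (range b) \<le> b k" for k by simp_all
    have "\<bar>b k - r\<bar> \<le> 1 / 2 * norm a" for k
      using p(2)[of i j] bnd[of k] unfolding ij r_def b_def[symmetric]
      by (simp add: abs_le_iff field_simps)
    then have le: "norm (diagonal_matrix (\<lambda>k. b k - r)) \<le> 1 / 2 * norm a" by (rule norm_diagonal_le)
    let ?p = "\<lambda>k::nat. if k = 1 then id else p"
    have "(\<lambda>i. (\<Sum>k=1..2. d (?p k i)) / real 2) = b"
      by (simp add: fun_eq_iff numeral_eq_Suc b_def)
    moreover have "bij (?p k)" for k using p by auto
    ultimately obtain v where v: "\<forall>k\<in>{1..2}. v k \<in> unitary_group"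
        "unitary_average 2 v a = u * diagonal_matrix b * star u"
      using unitary_average_permutations[OF u, of 2 ?p d] by (auto simp: a)
    have "norm (unitary_average 2 v a - r *\<^sub>R 1) \<le> 1 / 2 * norm a"
      using le by (simp add: v conj_diagonal_diff_scalar[OF u] norm_conj[OF u])
    then show ?thesis using v(1) scaleR_one_centre by blast
  qed
  then show ?thesis by (simp add: uniform_dixmier_property_def)
qed

text \<open>The centre trace is the mean of the eigenvalues, and a mean is only sure to lie within
  the full spread of each value. The spread must therefore fall from \<open>2 * s\<close> to
  \<open>s / 2\<close>, which takes two halvings.\<close>

theorem uniform_singleton_dixmier_cmatrix:
  "uniform_singleton_dixmier_property TYPE('n::finite cmatrix) 4 (1 / 2)"
proof -
  have "\<exists>v. (\<forall>k\<in>{1..4}. v k \<in> unitary_group) \<and>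
      norm (unitary_average 4 v a - centre_trace a) \<le> 1 / 2 * norm (a - centre_trace a)"
    if sa: "selfadjoint a" for a :: "'n cmatrix"
  proof -
    obtain u d where u: "u \<in> unitary_group" and a: "a = u * diagonal_matrix d * star u"
      using selfadjoint_diagonalizable[OF sa] by blast
    define t where "t = (\<Sum>i\<in>UNIV. d i) / real CARD('n)"
    have tr: "centre_trace a = t *\<^sub>R 1"
      by (simp only: centre_trace_cmatrix a normalized_trace_conj[OF u] normalized_trace_diagonal
          t_def scaleC_of_real)
    define s where "s = norm (a - t *\<^sub>R 1)"
    have "\<bar>d i - t\<bar> \<le> s" for i
      using abs_le_norm_diagonal[of "\<lambda>i. d i - t" i]
      by (simp add: s_def a conj_diagonal_diff_scalar[OF u] norm_conj[OF u])
    then have "d i - d j \<le> 2 * s" for i j by (smt (verit))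
    from halve_spread[of d, OF this] obtain p where p: "bij p"
        "\<And>i j. (d i + d (p i)) / 2 - (d j + d (p j)) / 2 \<le> s" by auto
    define b where "b i = (d i + d (p i)) / 2" for i
    have "b i - b j \<le> s" for i j using p(2) by (simp add: b_def)
    from halve_spread[of b, OF this] obtain q where q: "bij q"
        "\<And>i j. (b i + b (q i)) / 2 - (b j + b (q j)) / 2 \<le> s / 2" by blast
    define c where "c i = (b i + b (q i)) / 2" for i
    have reindex: "(\<Sum>i\<in>UNIV. f (g i)) = (\<Sum>i\<in>UNIV. f i)" if "bij g" for f :: "'n \<Rightarrow> real" and g :: "'n \<Rightarrow> 'n"
      by (rule sum.reindex_bij_betw) (rule that)
    \<comment> \<open>Averaging with a permuted copy preserves the sum, so \<open>t\<close> is also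
      the mean of \<open>b\<close> and of \<open>c\<close>.\<close>
    have "(\<Sum>i\<in>UNIV. b i) = (\<Sum>i\<in>UNIV. d i)"
      by (simp add: b_def sum_divide_distrib[symmetric] sum.distrib reindex p)
    then have "(\<Sum>i\<in>UNIV. c i) = (\<Sum>i\<in>UNIV. d i)"
      by (simp add: c_def sum_divide_distrib[symmetric] sum.distrib reindex q)
    then have t: "real CARD('n) * t = (\<Sum>i\<in>UNIV. c i)" by (simp add: t_def)
    have "\<bar>c i - t\<bar> \<le> 1 / 2 * s" for i
    proof -
      \<comment> \<open>The deviation from the mean is the average of the differences
        \<open>c i - c j\<close> over \<open>j\<close>, each at most \<open>s / 2\<close> in
        absolute value.\<close>
      have "real CARD('n) * \<bar>c i - t\<bar> = \<bar>real CARD('n) * c i - real CARD('n) * t\<bar>"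
        by (simp add: abs_mult right_diff_distrib[symmetric])
      also have "\<dots> = \<bar>\<Sum>j\<in>UNIV. c i - c j\<bar>" by (simp add: t sum_subtractf)
      also have "\<dots> \<le> (\<Sum>j\<in>(UNIV :: 'n set). s / 2)"
        using q(2) by (intro order_trans[OF sum_abs] sum_mono) (simp only: c_def abs_le_iff minus_diff_eq simp_thms)
      finally show ?thesis by simp
    qed
    then have le: "norm (diagonal_matrix (\<lambda>k. c k - t)) \<le> 1 / 2 * s" by (rule norm_diagonal_le)
    \<comment> \<open>Expanding \<open>c i\<close> in terms of \<open>d\<close> gives the values at
      \<open>i\<close>, \<open>p i\<close>, \<open>q i\<close> and \<open>p (q i)\<close>, each with
      weight 1/4.\<close>
    let ?p = "\<lambda>k::nat. if k = 1 then id else if k = 2 then p else if k = 3 then q else p \<circ> q"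
    have "(\<lambda>i. (\<Sum>k=1..4. d (?p k i)) / real 4) = c"
      by (simp add: fun_eq_iff numeral_eq_Suc c_def b_def field_simps)
    moreover have "bij (?p k)" for k using p q by (auto intro: bij_comp)
    ultimately obtain v where v: "\<forall>k\<in>{1..4}. v k \<in> unitary_group"
        "unitary_average 4 v a = u * diagonal_matrix c * star u"
      using unitary_average_permutations[OF u, of 4 ?p d] by (auto simp: a)
    have "norm (unitary_average 4 v a - t *\<^sub>R 1) \<le> 1 / 2 * s"
      using le by (simp add: v conj_diagonal_diff_scalar[OF u] norm_conj[OF u])
    then show ?thesis using v(1) by (auto simp: tr s_def)
  qed
  moreover have "singleton_dixmier_property TYPE('n cmatrix)"
    using dixmier_set_centre by (auto simp: singleton_dixmier_property_def)
  ultimately show ?thesis by (simp add: uniform_singleton_dixmier_property_def)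
qed

theorem proposition3p29:
  shows "uniform_dixmier_property TYPE('n::finite cmatrix) 2 (1 / 2) \<and>
         uniform_singleton_dixmier_property TYPE('n cmatrix) 4 (1 / 2)"
  using uniform_dixmier_cmatrix uniform_singleton_dixmier_cmatrix by blast

end
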